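(* If $P_3 = P_3 \land tt > \langle\rangle$ then $\mathbf{while}\; b \;\mathbf{do}\; \mathbf{R}_s(P_1 \vdash P_2 \diamond P_3) = \mathbf{R}_s\big(((([b]_r \mathbin{;} P_3)^{\star} \mathbin{;} [b]_r) \;\mathbf{wlp}_R\; P_1) \vdash (([b]_r \mathbin{;} P_3)^{\star} \mathbin{;} [b]_r \mathbin{;} P_2) \diamond (([b]_r \mathbin{;} P_3)^{\star} \mathbin{;} [\neg b]_r)\big)$.
   Context: $\mathbf{R}_s(P_1 \vdash P_2 \diamond P_3)$ is a stateful-failure reactive contract with precondition $P_1$, pericondition $P_2$, postcondition $P_3$ (reactive relations over state $st, st'$, trace contribution $tt \triangleq tr'-tr$, and refusals $ref'$). The reactive while loop is $\mathbf{while}\; b \;\mathbf{do}\; P \triangleq \mu X \bullet (P \mathbin{;} X) \triangleleft b \triangleright \mathbf{Skip}$ (weakest fixed point). $[b]_r \triangleq \Phi(b, id, \langle\rangle)$ is a reactive relational test, where $\Phi(s,\sigma,t) \triangleq \exists ref \bullet \mathbf{RR}(s \land st' = \sigma(st) \land tt = t)$. The inner star on reactive relations is $Q^{\star} \triangleq \mathrm{II}_c \sqcap \bigvee_{i\in\mathbb{N}} Q^{i+1}$ with $\mathrm{II}_c \triangleq (st'=st \land tr'=tr)$, $\sqcap$ being disjunction and $Q^{i}$ the $i$-fold sequential composition $\mathbin{;}$. The reactive weakest liberal precondition is $P \;\mathbf{wlp}_R\; Q \triangleq \neg_r(P \mathbin{;} \neg_r Q)$ with $\neg_r P \triangleq \neg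 P \land tr \le tr'$. *)

theory Defs
  imports "HOL-Library.Sublist" "HOL-Algebra.Complete_Lattice"
begin

text \<open>Alphabetised relations are binary predicates on the observation record: the first
  argument holds the undashed variables, the second the dashed ones. Implication is the pointwise
  order \<open>\<le>\<close>, sequential composition is \<open>OO\<close>, and \<open>n\<close>-fold composition is \<open>^^\<close>.\<close>

record ('s, 'e) obs =
  ok :: bool
  wait :: bool
  tr :: "'e list"
  st :: 's
  ref :: "'e set"

type_synonym ('s, 'e) urel = "('s, 'e) obs \<Rightarrow> ('s, 'e) obs \<Rightarrow> bool"

text \<open>The trace contribution \<open>tr' - tr\<close>; as usual for trace algebras, subtraction of a
  non-prefix yields the empty trace.\<close>

definition tt :: "('s, 'e) obs \<Rightarrow> ('s, 'e) obs \<Rightarrow> 'e list" where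
  "tt v v' = (if prefix (tr v) (tr v') then drop (length (tr v)) (tr v') else [])"


subsection \<open>Reactive relations and conditions\<close>

definition R1 :: "('s, 'e) urel \<Rightarrow> ('s, 'e) urel" where
  "R1 P = (\<lambda>v v'. P v v' \<and> prefix (tr v) (tr v'))"

definition R2c :: "('s, 'e) urel \<Rightarrow> ('s, 'e) urel" where
  "R2c P = (\<lambda>v v'. if prefix (tr v) (tr v')
                    then P (v\<lparr>tr := []\<rparr>) (v'\<lparr>tr := tt v v'\<rparr>) else P v v')"

definition RR :: "('s, 'e) urel \<Rightarrow> ('s, 'e) urel" where
  "RR P = (\<lambda>v v'. \<exists>k k' w w'. R1 (R2c P) (v\<lparr>ok := k, wait := w\<rparr>) (v'\<lparr>ok := k', wait := w'\<rparr>))"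

definition ex_ref :: "('s, 'e) urel \<Rightarrow> ('s, 'e) urel" where
  "ex_ref P = (\<lambda>v v'. \<exists>r. P (v\<lparr>ref := r\<rparr>) v')"

definition rea_true :: "('s, 'e) urel" where
  "rea_true = (\<lambda>v v'. prefix (tr v) (tr v'))"

definition rea_not :: "('s, 'e) urel \<Rightarrow> ('s, 'e) urel" where
  "rea_not P = (\<lambda>v v'. \<not> P v v' \<and> prefix (tr v) (tr v'))"

definition wlp_r :: "('s, 'e) urel \<Rightarrow> ('s, 'e) urel \<Rightarrow> ('s, 'e) urel" where
  "wlp_r P Q = rea_not (P OO rea_not Q)"

text \<open>Stateful-failure reactive relations do not depend on the initial refusals. A reactive
  condition is in addition such that its violation is closed under extension of the trace, and
  thus it does not depend on the final state and refusals either.\<close>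

definition is_CRR :: "('s, 'e) urel \<Rightarrow> bool" where
  "is_CRR P \<longleftrightarrow> ex_ref (RR P) = P"

definition is_CRC :: "('s, 'e) urel \<Rightarrow> bool" where
  "is_CRC P \<longleftrightarrow> is_CRR P \<and> rea_not (rea_not P OO rea_true) = P"

definition unrest_st' :: "('s, 'e) urel \<Rightarrow> bool" where
  "unrest_st' P \<longleftrightarrow> (\<forall>v v' s. P v (v'\<lparr>st := s\<rparr>) = P v v')"

definition unrest_ref' :: "('s, 'e) urel \<Rightarrow> bool" where
  "unrest_ref' P \<longleftrightarrow> (\<forall>v v' r. P v (v'\<lparr>ref := r\<rparr>) = P v v')"


subsection \<open>Stateful-failure reactive contracts\<close>

definition rea_skip :: "('s, 'e) urel" where
  "rea_skip = (\<lambda>v v'. v' = v \<or> (\<not> ok v \<and> prefix (tr v) (tr v')))"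

definition R3h :: "('s, 'e) urel \<Rightarrow> ('s, 'e) urel" where
  "R3h P = (\<lambda>v v'. if wait v then \<exists>s. rea_skip (v\<lparr>st := s\<rparr>) v' else P v v')"

definition RHS :: "('s, 'e) urel \<Rightarrow> ('s, 'e) urel" where
  "RHS P = R1 (R2c (R3h P))"

definition design :: "('s, 'e) urel \<Rightarrow> ('s, 'e) urel \<Rightarrow> ('s, 'e) urel" where
  "design P Q = (\<lambda>v v'. ok v \<and> P v v' \<longrightarrow> ok v' \<and> Q v v')"

definition wait'_cond :: "('s, 'e) urel \<Rightarrow> ('s, 'e) urel \<Rightarrow> ('s, 'e) urel" where
  "wait'_cond P Q = (\<lambda>v v'. if wait v' then P v v' else Q v v')"

definition contract ::
    "('s, 'e) urel \<Rightarrow> ('s, 'e) urel \<Rightarrow> ('s, 'e) urel \<Rightarrow> ('s, 'e) urel" where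
  "contract P1 P2 P3 = RHS (design P1 (wait'_cond P2 P3))"

definition wf_contract ::
    "('s, 'e) urel \<Rightarrow> ('s, 'e) urel \<Rightarrow> ('s, 'e) urel \<Rightarrow> bool" where
  "wf_contract P1 P2 P3 \<longleftrightarrow>
     is_CRC P1 \<and> is_CRR P2 \<and> unrest_st' P2 \<and> is_CRR P3 \<and> unrest_ref' P3"

text \<open>The refinement lattice of contracts. Its order is reverse implication, so that the least
  fixed point of the lattice is the weakest fixed point.\<close>

definition contract_order :: "('s, 'e) urel gorder" where
  "contract_order =
     \<lparr>carrier = {contract P1 P2 P3 | P1 P2 P3. wf_contract P1 P2 P3},
      eq = (=), le = (\<lambda>P Q. Q \<le> P)\<rparr>"


subsection \<open>While loop\<close>

definition Skip :: "('s, 'e) urel" where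
  "Skip = contract rea_true (\<lambda>v v'. False) (\<lambda>v v'. tr v' = tr v \<and> st v' = st v)"

definition cond_st :: "('s, 'e) urel \<Rightarrow> ('s \<Rightarrow> bool) \<Rightarrow> ('s, 'e) urel \<Rightarrow> ('s, 'e) urel" where
  "cond_st P b Q = (\<lambda>v v'. if b (st v) then P v v' else Q v v')"

definition While :: "('s \<Rightarrow> bool) \<Rightarrow> ('s, 'e) urel \<Rightarrow> ('s, 'e) urel" where
  "While b P = LFP\<^bsub>contract_order\<^esub> (\<lambda>X. cond_st (P OO X) b Skip)"


subsection \<open>Reactive tests and iteration\<close>

definition Phi :: "('s \<Rightarrow> bool) \<Rightarrow> ('s \<Rightarrow> 's) \<Rightarrow> ('s \<Rightarrow> 'e list) \<Rightarrow> ('s, 'e) urel" where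
  "Phi s \<sigma> t = ex_ref (RR (\<lambda>v v'. s (st v) \<and> st v' = \<sigma> (st v) \<and> tt v v' = t (st v)))"

definition rea_test :: "('s \<Rightarrow> bool) \<Rightarrow> ('s, 'e) urel" where
  "rea_test b = Phi b id (\<lambda>s. [])"

definition II_c :: "('s, 'e) urel" where
  "II_c = (\<lambda>v v'. st v' = st v \<and> tr v' = tr v)"

definition rea_star :: "('s, 'e) urel \<Rightarrow> ('s, 'e) urel" where
  "rea_star Q = (\<lambda>v v'. II_c v v' \<or> (\<exists>i. (Q ^^ (i + 1)) v v'))"

end

theory Submission
  imports Defs
begin

text \<open>The right-hand side \<open>W\<close> is shown to be the weakest \<open>X\<close> with \<open>X \<le> (P OO X) \<triangleleft> b \<triangleright> Skip\<close>, which
  makes it the least fixed point without appeal to completeness of the lattice. That \<open>W\<close> has this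
  property is the unfolding law of the star. Conversely, since every terminating
  execution of the body strictly extends the trace, \<open>X v v' \<longrightarrow> W v v'\<close> follows by strong induction on
  the length of the trace contribution.\<close>

section \<open>Reactive relations\<close>

text \<open>Normal form of the healthiness closure: only the two states, the trace contribution and
  the final refusals survive, since \<open>ok\<close>, \<open>wait\<close> and the initial refusals
  are quantified away.\<close>

lemma ex_ref_RR_iff:
  "ex_ref (RR P) v v' \<longleftrightarrow>
     (\<exists>t. tr v' = tr v @ t \<and>
       (\<exists>r k k' w w'. P \<lparr>ok = k, wait = w, tr = [], st = st v, ref = r\<rparr>
                          \<lparr>ok = k', wait = w', tr = t, st = st v', ref = ref v'\<rparr>))"
proof (cases v; cases v')
  fix k w x s r k' w' x' s' r'
  assume [simp]: "v = \<lparr>ok = k, wait = w, tr = x, st = s, ref = r\<rparr>"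
    "v' = \<lparr>ok = k', wait = w', tr = x', st = s', ref = r'\<rparr>"
  show ?thesis
    by (auto simp: ex_ref_def RR_def R1_def R2c_def tt_def prefix_def) blast+
qed

lemma CRR_prefix: "is_CRR P \<Longrightarrow> P v v' \<Longrightarrow> prefix (tr v) (tr v')"
  unfolding is_CRR_def by (metis ex_ref_RR_iff prefix_def)

text \<open>The working form of \<open>is_CRR\<close>: observations may be translated along the
  trace, and \<open>ok\<close>, \<open>wait\<close> and the initial refusals may be reset at
  will.\<close>

lemma CRR_cong:
  assumes "is_CRR P" "st v = st w" "st v' = st w'" "ref v' = ref w'"
    "tr v' = tr v @ t" "tr w' = tr w @ t"
  shows "P v v' \<longleftrightarrow> P w w'"
proof -
  have "ex_ref (RR P) v v' \<longleftrightarrow> ex_ref (RR P) w w'"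
    using assms(2-) by (simp add: ex_ref_RR_iff)
  then show ?thesis
    using assms(1) by (simp add: is_CRR_def)
qed

text \<open>Converse of \<open>CRR_prefix\<close> and \<open>CRR_cong\<close>: the two properties
  together characterise healthiness.\<close>

lemma is_CRR_I:
  assumes "\<And>v v'. P v v' \<Longrightarrow> prefix (tr v) (tr v')"
    and "\<And>v v' w w' t. \<lbrakk>P v v'; st v = st w; st v' = st w'; ref v' = ref w';
           tr v' = tr v @ t; tr w' = tr w @ t\<rbrakk> \<Longrightarrow> P w w'"
  shows "is_CRR P"
  unfolding is_CRR_def
proof (intro ext iffI)
  fix v v'
  assume "ex_ref (RR P) v v'"
  then show "P v v'"
    by (auto simp: ex_ref_RR_iff elim!: assms(2))
next
  fix v v'
  assume P: "P v v'"
  then obtain t where t: "tr v' = tr v @ t"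
    using assms(1) prefix_def by blast
  have "P \<lparr>ok = k, wait = w, tr = [], st = st v, ref = r\<rparr>
          \<lparr>ok = k', wait = w', tr = t, st = st v', ref = ref v'\<rparr>" for r k k' w w'
    by (rule assms(2)[OF P]) (simp_all add: t)
  then show "ex_ref (RR P) v v'"
    using t by (auto simp: ex_ref_RR_iff)
qed

lemma CRR_OO:
  assumes "is_CRR P" "is_CRR Q"
  shows "is_CRR (P OO Q)"
proof (rule is_CRR_I)
  fix v v'
  assume "(P OO Q) v v'"
  then show "prefix (tr v) (tr v')"
    using CRR_prefix[OF assms(1)] CRR_prefix[OF assms(2)] prefix_order.trans by blast
next
  fix v v' w w' :: "('a, 'b) obs" and t
  assume *: "(P OO Q) v v'" "st v = st w" "st v' = st w'" "ref v' = ref w'"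
    "tr v' = tr v @ t" "tr w' = tr w @ t"
  then obtain m where m: "P v m" "Q m v'"
    by blast
  obtain t1 t2 where t1: "tr m = tr v @ t1" and t2: "tr v' = tr m @ t2"
    using CRR_prefix[OF assms(1) m(1)] CRR_prefix[OF assms(2) m(2)] by (auto simp: prefix_def)
  \<comment> \<open>The intermediate observation is translated so that the first relation still
    contributes \<open>t1\<close> and the second \<open>t2\<close>.\<close>
  let ?m = "m\<lparr>tr := tr w @ t1\<rparr>"
  have "P w ?m"
    using CRR_cong[OF assms(1), of v w m ?m t1] * m t1 by simp
  moreover have "Q ?m w'"
    using CRR_cong[OF assms(2), of m ?m v' w' t2] * m t1 t2 by simp
  ultimately show "(P OO Q) w w'"
    by blast
qed

lemma CRR_rea_not:
  assumes "is_CRR P"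
  shows "is_CRR (rea_not P)"
proof (rule is_CRR_I)
  fix v v' w w' :: "('a, 'b) obs" and t
  assume "rea_not P v v'" "st v = st w" "st v' = st w'" "ref v' = ref w'"
    "tr v' = tr v @ t" "tr w' = tr w @ t"
  then show "rea_not P w w'"
    using CRR_cong[OF assms, of v w v' w' t] by (simp add: rea_not_def)
qed (simp add: rea_not_def)

lemma CRR_rea_true: "is_CRR rea_true"
  by (rule is_CRR_I) (auto simp: rea_true_def)

lemma CRR_False: "is_CRR (\<lambda>v v'. False)"
  by (rule is_CRR_I) auto

lemma CRR_II_c: "is_CRR II_c"
  by (rule is_CRR_I) (auto simp: II_c_def)

section \<open>Tests and the units of composition\<close>

lemma rea_test_iff: "rea_test b v v' \<longleftrightarrow> b (st v) \<and> II_c v v'"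
  by (auto simp: rea_test_def Phi_def ex_ref_RR_iff II_c_def tt_def)

lemma CRR_rea_test: "is_CRR (rea_test b)"
  by (rule is_CRR_I) (auto simp: rea_test_iff II_c_def)

text \<open>\<open>II_c\<close> leaves \<open>ok\<close>, \<open>wait\<close> and the refusals of
  the intermediate observation free, but a healthy \<open>P\<close> does not read these from its
  first argument.\<close>

lemma II_c_OO:
  assumes "is_CRR P"
  shows "II_c OO P = P"
proof (intro ext iffI)
  fix v v'
  assume "(II_c OO P) v v'"
  then obtain m where m: "st m = st v" "tr m = tr v" "P m v'"
    by (auto simp: II_c_def)
  then obtain t where "tr v' = tr v @ t"
    using CRR_prefix[OF assms m(3)] by (auto simp: prefix_def)
  then show "P v v'"
    using m CRR_cong[OF assms, of m v v' v' t] by simp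
qed (auto simp: II_c_def)

lemma rea_test_OO:
  assumes "is_CRR P"
  shows "(rea_test b OO P) v v' \<longleftrightarrow> b (st v) \<and> P v v'"
proof -
  have "(rea_test b OO P) v v' \<longleftrightarrow> b (st v) \<and> (II_c OO P) v v'"
    by (auto simp: rea_test_iff)
  then show ?thesis
    by (simp add: II_c_OO[OF assms])
qed

text \<open>On the right, the refusals that \<open>II_c\<close> leaves free are final ones, hence
  the demand \<open>unrest_ref'\<close>.\<close>

lemma OO_II_c:
  assumes "is_CRR P" "unrest_ref' P"
  shows "P OO II_c = P"
proof (intro ext iffI)
  fix v v'
  assume "(P OO II_c) v v'"
  then obtain m where m: "st v' = st m" "tr v' = tr m" "P v m"
    by (auto simp: II_c_def)
  then obtain t where "tr m = tr v @ t"
    using CRR_prefix[OF assms(1) m(3)] by (auto simp: prefix_def)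
  then have "P v (v'\<lparr>ref := ref m\<rparr>)"
    using m CRR_cong[OF assms(1), of v v m "v'\<lparr>ref := ref m\<rparr>" t] by simp
  then show "P v v'"
    using assms(2) by (simp add: unrest_ref'_def)
qed (auto simp: II_c_def)

text \<open>Once a trailing \<open>II_c\<close> is absorbed, only the state and trace of the second
  argument matter. This later turns an arbitrary intermediate observation into one that is
  \<open>ok\<close> and not waiting.\<close>

lemma CRR_ok_wait_iff:
  assumes "is_CRR P" "unrest_ref' P"
  shows "P v (m\<lparr>ok := k, wait := w\<rparr>) \<longleftrightarrow> P v m"
proof -
  have "P v m' \<Longrightarrow> st m'' = st m' \<Longrightarrow> tr m'' = tr m' \<Longrightarrow> P v m''" for m' m''
    using OO_II_c[OF assms] by (metis II_c_def relcomppI)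
  then show ?thesis
    by (metis obs.select_convs(3,4) obs.simps(1) obs.surjective obs.update_convs(1,2))
qed

section \<open>Powers and iteration\<close>

lemma CRR_relpowp: "is_CRR Q \<Longrightarrow> is_CRR (Q ^^ Suc i)"
proof (induction i)
  case 0
  then show ?case by (simp add: OO_def)
next
  case (Suc i)
  then show ?case
    by (metis CRR_OO relpowp.simps(2))
qed

text \<open>In the star, \<open>II_c\<close> stands for the zeroth power: plain equality of
  observations would relate \<open>ok\<close> and \<open>wait\<close> to their dashed versions and
  so not be healthy.\<close>

lemma CRR_rea_star:
  assumes "is_CRR Q"
  shows "is_CRR (rea_star Q)"
proof (rule is_CRR_I)
  fix v v'
  assume "rea_star Q v v'"
  then show "prefix (tr v) (tr v')"
    using CRR_prefix[OF CRR_relpowp[OF assms]] by (auto simp: rea_star_def II_c_def)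
next
  fix v v' w w' :: "('a, 'b) obs" and t
  assume *: "rea_star Q v v'" and
    cong: "st v = st w" "st v' = st w'" "ref v' = ref w'" "tr v' = tr v @ t" "tr w' = tr w @ t"
  show "rea_star Q w w'"
    using * CRR_cong[OF CRR_II_c cong] CRR_cong[OF CRR_relpowp[OF assms] cong]
    by (auto simp: rea_star_def simp del: relpowp.simps)
qed

text \<open>The law rests on \<open>Q\<close> absorbing a trailing \<open>II_c\<close>: the first
  power is then \<open>Q\<close> followed by the \<open>II_c\<close> branch of the star.\<close>

lemma rea_star_unfold:
  assumes "Q OO II_c = Q"
  shows "rea_star Q v v' \<longleftrightarrow> II_c v v' \<or> (Q OO rea_star Q) v v'"
proof
  assume "rea_star Q v v'"
  then consider "II_c v v'" | i where "(Q ^^ Suc i) v v'"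
    by (auto simp: rea_star_def simp del: relpowp.simps)
  then show "II_c v v' \<or> (Q OO rea_star Q) v v'"
  proof cases
    case 2
    show ?thesis
    proof (cases i)
      case 0
      then have "(Q OO II_c) v v'"
        using 2 assms by (simp add: OO_def)
      then show ?thesis
        by (auto simp: rea_star_def)
    next
      case (Suc j)
      \<comment> \<open>\<open>^^\<close> appends its factors on the right, whereas the unfolding
        peels one off on the left.\<close>
      then obtain m where "Q v m" "(Q ^^ (j + 1)) m v'"
        using relpowp_Suc_D2[of "Suc j"] 2 by (metis Suc_eq_plus1)
      then show ?thesis
        unfolding rea_star_def by blast
    qed
  qed simp
next
  assume "II_c v v' \<or> (Q OO rea_star Q) v v'"
  then consider "II_c v v'" | m where "Q v m" "II_c m v'" | m i where "Q v m" "(Q ^^ (i + 1)) m v'"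
    unfolding rea_star_def by blast
  then show "rea_star Q v v'"
  proof cases
    case 2
    then have "Q v v'"
      using assms by (metis relcomppI)
    then have "(Q ^^ (0 + 1)) v v'"
      by (simp add: OO_def)
    then show ?thesis
      unfolding rea_star_def by blast
  next
    case 3
    then have "(Q ^^ (Suc i + 1)) v v'"
      using relpowp_Suc_I2 by (metis Suc_eq_plus1)
    then show ?thesis
      unfolding rea_star_def by blast
  qed (simp add: rea_star_def)
qed

text \<open>The recursion shared by all three components of the loop contract: each, the
  precondition in negated form, is a star followed by a healthy tail \<open>A\<close>.\<close>

lemma rea_star_OO_unfold:
  assumes "Q OO II_c = Q" "is_CRR A"
  shows "(rea_star Q OO A) v v' \<longleftrightarrow> A v v' \<or> (Q OO (rea_star Q OO A)) v v'"
proof -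
  have "(rea_star Q OO A) v v' \<longleftrightarrow> (II_c OO A) v v' \<or> (Q OO (rea_star Q OO A)) v v'"
    using rea_star_unfold[OF assms(1)] by blast
  then show ?thesis
    by (simp add: II_c_OO[OF assms(2)])
qed

lemma unrest_st'_OO: "unrest_st' Q \<Longrightarrow> unrest_st' (P OO Q)"
  by (auto simp: unrest_st'_def)

lemma unrest_ref'_OO: "unrest_ref' Q \<Longrightarrow> unrest_ref' (P OO Q)"
  by (auto simp: unrest_ref'_def)

section \<open>Reactive conditions\<close>

lemma rea_not_rea_not: "is_CRR P \<Longrightarrow> rea_not (rea_not P) = P"
  by (auto simp: rea_not_def fun_eq_iff dest: CRR_prefix)

text \<open>Negating both sides of the defining equation of \<open>is_CRC\<close> shows that
  violations are closed under trace extension.\<close>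

lemma CRC_not_OO_true:
  assumes "is_CRC P"
  shows "rea_not P OO rea_true = rea_not P"
proof -
  have "is_CRR P"
    using assms by (simp add: is_CRC_def)
  then have "is_CRR (rea_not P OO rea_true)"
    by (intro CRR_OO CRR_rea_not CRR_rea_true)
  then show ?thesis
    using assms rea_not_rea_not by (metis is_CRC_def)
qed

text \<open>Pointwise form of that closure, with arbitrary state and refusals in the later
  observation. It carries violations between intermediate and final observations.\<close>

lemma CRC_not_extend:
  assumes "is_CRC P" "\<not> P v m" "prefix (tr v) (tr m)" "prefix (tr m) (tr v')"
  shows "\<not> P v v'"
proof -
  have "(rea_not P OO rea_true) v v'"
    using assms by (auto simp: rea_not_def rea_true_def)
  then have "rea_not P v v'"
    by (simp only: CRC_not_OO_true[OF assms(1)])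
  then show ?thesis
    by (simp add: rea_not_def)
qed

lemma CRC_rea_true: "is_CRC rea_true"
  by (auto simp: is_CRC_def CRR_rea_true) (auto simp: rea_not_def rea_true_def fun_eq_iff)

text \<open>The violation of \<open>wlp_r A P\<close> is \<open>A OO rea_not P\<close>, which
  inherits closure under extension from its right factor by associativity.\<close>

lemma CRC_wlp_r:
  assumes "is_CRR A" "is_CRC P"
  shows "is_CRC (wlp_r A P)"
proof -
  have "is_CRR P"
    using assms(2) by (simp add: is_CRC_def)
  then have CRR: "is_CRR (A OO rea_not P)"
    using assms(1) by (intro CRR_OO CRR_rea_not)
  have "rea_not (wlp_r A P) OO rea_true = A OO rea_not P"
    by (simp add: wlp_r_def rea_not_rea_not[OF CRR] relcompp_assoc CRC_not_OO_true[OF assms(2)])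
  then show ?thesis
    using CRR_rea_not[OF CRR] by (simp add: is_CRC_def wlp_r_def)
qed

section \<open>Contracts\<close>

text \<open>Healthy components do not notice the shift made by \<open>R2c\<close>, so the closures
  disappear. Divergence, from a false \<open>ok\<close> or a violated precondition, only forces the
  trace to grow.\<close>

lemma contract_iff:
  assumes "is_CRR P1" "is_CRR P2" "is_CRR P3"
  shows "contract P1 P2 P3 v v' \<longleftrightarrow> prefix (tr v) (tr v') \<and>
    (ok v \<longrightarrow> (if wait v then \<exists>s. v' = v\<lparr>st := s\<rparr>
       else P1 v v' \<longrightarrow> ok v' \<and> (if wait v' then P2 v v' else P3 v v')))"
proof (cases "prefix (tr v) (tr v')")
  case True
  then obtain t where t: "tr v' = tr v @ t"
    by (auto simp: prefix_def)
  have *: "P (v\<lparr>tr := []\<rparr>) (v'\<lparr>tr := t\<rparr>) \<longleftrightarrow> P v v'" if "is_CRR P" for P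
    by (rule CRR_cong[OF that, where t = t]) (simp_all add: t)
  \<comment> \<open>The waiting branch equates whole observations, so \<open>CRR_cong\<close> does
    not cover it; here the shift is harmless because both sides force \<open>t = []\<close>.\<close>
  have **: "v'\<lparr>tr := t\<rparr> = v\<lparr>tr := [], st := s\<rparr> \<longleftrightarrow> v' = v\<lparr>st := s\<rparr>" for s
    using t by (cases v; cases v') auto
  show ?thesis
    using t
    by (auto simp: contract_def tt_def RHS_def R1_def R2c_def R3h_def design_def wait'_cond_def
        rea_skip_def * assms **)
qed (simp add: contract_def RHS_def R1_def)

lemma Skip_iff:
  fixes v v' :: "('s, 'e) obs"
  shows "Skip v v' \<longleftrightarrow> prefix (tr v) (tr v') \<and>
    (ok v \<longrightarrow> (if wait v then \<exists>s. v' = v\<lparr>st := s\<rparr> else ok v' \<and> \<not> wait v' \<and> II_c v v'))"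
proof -
  have "Skip = (contract rea_true (\<lambda>v v'. False) II_c :: ('s, 'e) urel)"
    by (simp add: Skip_def II_c_def conj_commute)
  then have "Skip v v' \<longleftrightarrow> contract rea_true (\<lambda>v v'. False) II_c v v'"
    by (rule arg_cong)
  also have "\<dots> \<longleftrightarrow> prefix (tr v) (tr v') \<and>
    (ok v \<longrightarrow> (if wait v then \<exists>s. v' = v\<lparr>st := s\<rparr> else ok v' \<and> \<not> wait v' \<and> II_c v v'))"
    using contract_iff[OF CRR_rea_true CRR_False CRR_II_c, of v v'] by (auto simp: rea_true_def)
  finally show ?thesis .
qed

text \<open>Only the first contract is opened up, to match one unfolding of the loop. If it waits,
  the second one copies everything but the state, which \<open>P2\<close> ignores; if
  \<open>P1\<close> fails at the intermediate observation, it fails at the final one too.\<close>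

lemma contract_OO_iff:
  assumes P: "wf_contract P1 P2 P3" and Q: "wf_contract Q1 Q2 Q3"
  shows "(contract P1 P2 P3 OO contract Q1 Q2 Q3) v v' \<longleftrightarrow> prefix (tr v) (tr v') \<and>
    (ok v \<longrightarrow> (if wait v then \<exists>s. v' = v\<lparr>st := s\<rparr>
       else \<not> P1 v v' \<or> (ok v' \<and> wait v' \<and> P2 v v') \<or>
         (\<exists>m. ok m \<and> \<not> wait m \<and> P3 v m \<and> contract Q1 Q2 Q3 m v')))"
    (is "(?P OO ?Q) v v' \<longleftrightarrow> ?R")
proof -
  have CRR: "is_CRR P1" "is_CRR P2" "is_CRR P3" and "is_CRR Q1" "is_CRR Q2" "is_CRR Q3"
    and CRC: "is_CRC P1" and st: "unrest_st' P2"
    using assms by (auto simp: wf_contract_def is_CRC_def)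
  note P_iff = contract_iff[OF CRR]
    and Q_iff = contract_iff[OF \<open>is_CRR Q1\<close> \<open>is_CRR Q2\<close> \<open>is_CRR Q3\<close>]
  show ?thesis
  proof
    assume "(?P OO ?Q) v v'"
    then obtain m where m: "?P v m" "?Q m v'"
      by blast
    then have pre: "prefix (tr v) (tr m)" "prefix (tr m) (tr v')"
      by (auto simp: P_iff Q_iff)
    then have "prefix (tr v) (tr v')"
      by (rule prefix_order.trans)
    moreover have "\<exists>s. v' = v\<lparr>st := s\<rparr>" if "ok v" "wait v"
      using that m by (auto simp: P_iff Q_iff)
    moreover have "\<not> P1 v v' \<or> (ok v' \<and> wait v' \<and> P2 v v') \<or>
         (\<exists>m. ok m \<and> \<not> wait m \<and> P3 v m \<and> ?Q m v')" if v: "ok v" "\<not> wait v"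
    proof (cases "P1 v m")
      case True
      then have "ok m" and *: "if wait m then P2 v m else P3 v m"
        using v m(1) by (auto simp: P_iff)
      show ?thesis
      proof (cases "wait m")
        case True
        then obtain s where "v' = m\<lparr>st := s\<rparr>"
          using m(2) \<open>ok m\<close> by (auto simp: Q_iff)
        then show ?thesis
          using st True \<open>ok m\<close> * by (simp add: unrest_st'_def)
      next
        case False
        then show ?thesis
          using \<open>ok m\<close> * m(2) by auto
      qed
    next
      case False
      then show ?thesis
        using CRC_not_extend[OF CRC _ pre] by blast
    qed
    ultimately show ?R
      by simp
  next
    assume R: ?R
    consider "\<not> ok v" | "ok v" "wait v" | "ok v" "\<not> wait v" "\<not> P1 v v'"
      | "ok v" "\<not> wait v" "ok v'" "wait v'" "P2 v v'"
      | m where "ok v" "\<not> wait v" "ok m" "\<not> wait m" "P3 v m" "?Q m v'"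
      using R by (cases "ok v"; cases "wait v") auto
    then show "(?P OO ?Q) v v'"
    proof cases
      case 1
      then have "?P v v" "?Q v v'"
        using R by (auto simp: P_iff Q_iff)
      then show ?thesis by blast
    next
      case 2
      then have "?P v v" "?Q v v'"
        using R by (auto simp: P_iff Q_iff intro: exI[of _ "st v"])
      then show ?thesis by blast
    next
      case 3
      \<comment> \<open>From an observation with \<open>ok\<close> false the second contract admits
        any extension of the trace, so divergence is routed through this witness.\<close>
      let ?m = "v'\<lparr>ok := False\<rparr>"
      have "\<not> P1 v ?m"
        using CRC_not_extend[OF CRC, of v v' ?m] R 3 by simp
      then have "?P v ?m" "?Q ?m v'"
        using R 3 by (auto simp: P_iff Q_iff)
      then show ?thesis by blast
    next
      case 4
      \<comment> \<open>A waiting observation may pass through the second contract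
        unchanged.\<close>
      then have "?P v v'" "?Q v' v'"
        using R by (auto simp: P_iff Q_iff intro: exI[of _ "st v'"])
      then show ?thesis by blast
    next
      case 5
      then have "?P v m"
        using CRR_prefix[OF CRR(3)] by (auto simp: P_iff)
      then show ?thesis
        using 5 by blast
    qed
  qed
qed

text \<open>In the reversed order, \<open>LFP\<close> is the infimum of all \<open>X\<close> with
  \<open>X \<le> F X\<close>. As \<open>W\<close> belongs to this set and bounds it,
  \<open>W\<close> is the infimum.\<close>

lemma LFP_contract_eqI:
  assumes "W \<in> carrier contract_order" "W \<le> F W"
    and "\<And>X. X \<in> carrier contract_order \<Longrightarrow> X \<le> F X \<Longrightarrow> X \<le> W"
  shows "LFP\<^bsub>contract_order\<^esub> F = W"
proof -
  have le: "le contract_order X Y \<longleftrightarrow> Y \<le> X" for X Y :: "('a, 'b) urel"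
    by (simp add: contract_order_def)
  let ?A = "{X \<in> carrier contract_order. X \<le> F X}"
  have "greatest contract_order W (Lower contract_order ?A)"
    using assms by (auto simp: greatest_def Lower_def le)
  \<comment> \<open>\<open>inf\<close> is a Hilbert choice, so uniqueness of the greatest lower
    bound is needed as well.\<close>
  moreover have "X = W" if "greatest contract_order X (Lower contract_order ?A)" for X
  proof -
    have "X \<in> Lower contract_order ?A" "W \<in> Lower contract_order ?A"
      using that calculation by (auto simp: greatest_def)
    then have "le contract_order W X" "le contract_order X W"
      using that calculation by (auto simp: greatest_def)
    then show ?thesis
      by (simp add: le order_antisym)
  qed
  ultimately have "(SOME X. greatest contract_order X (Lower contract_order ?A)) = W"
    by (rule some_equality)
  then show ?thesis
    by (simp add: LEAST_FP_def inf_def le)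
qed

section \<open>While loops\<close>

theorem theorem25:
  fixes b :: "'s \<Rightarrow> bool"
    and P1 P2 P3 :: "('s, 'e) urel"
  assumes "wf_contract P1 P2 P3"
    and "P3 = (\<lambda>v v'. P3 v v' \<and> strict_prefix [] (tt v v'))"
  shows "While b (contract P1 P2 P3) =
    contract
      (wlp_r (rea_star (rea_test b OO P3) OO rea_test b) P1)
      (rea_star (rea_test b OO P3) OO rea_test b OO P2)
      (rea_star (rea_test b OO P3) OO rea_test (\<lambda>s. \<not> b s))"
proof -
  have CRR: "is_CRR P1" "is_CRR P2" "is_CRR P3" and CRC: "is_CRC P1"
    and st: "unrest_st' P2" and ref: "unrest_ref' P3"
    using assms(1) by (auto simp: wf_contract_def is_CRC_def)
  define Q where "Q = rea_test b OO P3"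
  define W1 where "W1 = wlp_r (rea_star Q OO rea_test b) P1"
  define W2 where "W2 = rea_star Q OO rea_test b OO P2"
  define W3 where "W3 = rea_star Q OO rea_test (\<lambda>s. \<not> b s)"
  define W where "W = contract W1 W2 W3"
  have CRR_Q: "is_CRR Q" and CRR_S: "is_CRR (rea_star Q)"
    by (simp_all add: Q_def CRR_OO CRR_rea_test CRR CRR_rea_star)
  have Q_II: "Q OO II_c = Q"
    by (rule OO_II_c[OF CRR_Q]) (simp add: Q_def unrest_ref'_OO ref)
  have Q_iff: "Q v v' \<longleftrightarrow> b (st v) \<and> P3 v v'" for v v'
    by (simp add: Q_def rea_test_OO CRR)
  have wf_W: "wf_contract W1 W2 W3"
  proof -
    have "unrest_ref' (rea_test (\<lambda>s. \<not> b s) :: ('s, 'e) urel)"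
      by (simp add: unrest_ref'_def rea_test_iff II_c_def)
    then show ?thesis
      unfolding wf_contract_def W1_def W2_def W3_def
      by (intro conjI CRC_wlp_r CRR_OO CRR_S CRR_rea_test CRC CRR unrest_st'_OO unrest_ref'_OO st)
  qed
  then have CRR_W: "is_CRR W1" "is_CRR W2" "is_CRR W3"
    by (auto simp: wf_contract_def is_CRC_def)
  note W_iff = contract_iff[OF CRR_W, folded W_def]
  have W2: "W2 v v' \<longleftrightarrow> b (st v) \<and> (P2 v v' \<or> (\<exists>m. P3 v m \<and> W2 m v'))" for v v'
  proof -
    have "W2 v v' \<longleftrightarrow> (rea_test b OO P2) v v' \<or> (Q OO W2) v v'"
      unfolding W2_def by (rule rea_star_OO_unfold[OF Q_II]) (intro CRR_OO CRR_rea_test CRR)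
    then show ?thesis
      using rea_test_OO[OF CRR(2)] by (auto simp: Q_iff)
  qed
  have W3: "W3 v v' \<longleftrightarrow> (\<not> b (st v) \<and> II_c v v') \<or> (b (st v) \<and> (\<exists>m. P3 v m \<and> W3 m v'))" for v v'
  proof -
    have "W3 v v' \<longleftrightarrow> rea_test (\<lambda>s. \<not> b s) v v' \<or> (Q OO W3) v v'"
      unfolding W3_def by (rule rea_star_OO_unfold[OF Q_II]) (intro CRR_rea_test)
    then show ?thesis
      by (auto simp: rea_test_iff Q_iff)
  qed
  \<comment> \<open>The precondition is unfolded through its negation, because it is the violation
    of a \<open>wlp_r\<close> that is a composition beginning with the star.\<close>
  have not_W1: "rea_not W1 v v' \<longleftrightarrow>
    b (st v) \<and> (rea_not P1 v v' \<or> (\<exists>m. P3 v m \<and> rea_not W1 m v'))" for v v'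
  proof -
    have CRR_P: "is_CRR (rea_not P1)" "is_CRR (rea_test b OO rea_not P1)"
      by (simp_all add: CRR_OO CRR_rea_test CRR_rea_not CRR)
    have *: "rea_not W1 = rea_star Q OO rea_test b OO rea_not P1"
      by (simp add: W1_def wlp_r_def relcompp_assoc rea_not_rea_not CRR_OO CRR_S CRR_P)
    have "rea_not W1 v v' \<longleftrightarrow> (rea_test b OO rea_not P1) v v' \<or> (Q OO rea_not W1) v v'"
      unfolding * by (rule rea_star_OO_unfold[OF Q_II CRR_P(2)])
    then show ?thesis
      using rea_test_OO[OF CRR_P(1)] by (auto simp: Q_iff)
  qed
  let ?P = "contract P1 P2 P3"
  let ?F = "\<lambda>X. cond_st (?P OO X) b Skip"

  have "W \<in> carrier contract_order"
    using wf_W by (auto simp: contract_order_def W_def)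
  moreover have "W \<le> ?F W"
  proof (intro predicate2I)
    fix v v'
    assume *: "W v v'"
    then have pre: "prefix (tr v) (tr v')"
      by (simp add: W_iff)
    have step: "(?P OO W) v v'" if "ok v" "\<not> wait v" "b (st v)"
    proof -
      have unfold: ?thesis if "\<not> P1 v v' \<or> (ok v' \<and> wait v' \<and> P2 v v') \<or>
          (\<exists>m. ok m \<and> \<not> wait m \<and> P3 v m \<and> W m v')"
        using that pre \<open>ok v\<close> \<open>\<not> wait v\<close>
        by (simp add: contract_OO_iff[OF assms(1) wf_W, folded W_def])
      \<comment> \<open>One iteration through \<open>P3\<close> reaches \<open>m\<close>, from where
        the rest of the loop either diverges or meets its peri- or postcondition.\<close>
      have body: ?thesis if m: "P3 v m" and
        W: "rea_not W1 m v' \<or> (ok v' \<and> (if wait v' then W2 m v' else W3 m v'))" for m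
      proof -
        \<comment> \<open>The unfolding laws say nothing about \<open>ok\<close> and
          \<open>wait\<close> of \<open>m\<close>, while handing over between contracts needs these
          values; healthiness permits setting them.\<close>
        let ?m = "m\<lparr>ok := True, wait := False\<rparr>"
        have "prefix (tr m) (tr v')"
          using W CRR_prefix[OF CRR_W(2), of m v'] CRR_prefix[OF CRR_W(3), of m v']
          by (auto simp: rea_not_def split: if_splits)
        then obtain t where t: "tr v' = tr m @ t"
          by (auto simp: prefix_def)
        have cong: "A m v' \<longleftrightarrow> A ?m v'" if "is_CRR A" for A
          by (rule CRR_cong[OF that, where t = t]) (simp_all add: t)
        have "W ?m v'"
          using W cong[OF CRR_W(2)] cong[OF CRR_W(3)] cong[OF CRR_rea_not[OF CRR_W(1)]] t
          by (auto simp: W_iff rea_not_def)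
        moreover have "P3 v ?m"
          using m by (simp add: CRR_ok_wait_iff CRR ref)
        ultimately show ?thesis
          by (intro unfold) (auto intro!: exI[of _ ?m])
      qed
      show ?thesis
      proof (cases "W1 v v'")
        case True
        then have "ok v'" "if wait v' then W2 v v' else W3 v v'"
          using * that by (auto simp: W_iff)
        then show ?thesis
          using unfold body W2[of v v'] W3[of v v'] that by (auto split: if_splits)
      next
        case False
        then have "rea_not W1 v v'"
          using pre by (simp add: rea_not_def)
        then show ?thesis
          using unfold body not_W1[of v v'] by (auto simp: rea_not_def[of P1])
      qed
    qed
    have stop: "Skip v v'" if "ok v" "\<not> wait v" "\<not> b (st v)"
    proof -
      \<comment> \<open>By \<open>not_W1\<close>, a violation of \<open>W1\<close> requires the
        guard to hold initially.\<close>
      have "W1 v v'"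
        using not_W1[of v v'] that pre by (auto simp: rea_not_def)
      then show ?thesis
        using * that W2[of v v'] W3[of v v'] by (auto simp: W_iff Skip_iff split: if_splits)
    qed
    show "?F W v v'"
    proof (cases "ok v \<and> \<not> wait v")
      case True
      then show ?thesis
        using step stop by (simp add: cond_st_def)
    next
      case False
      then show ?thesis
        using * contract_OO_iff[OF assms(1) wf_W, folded W_def, of v v']
        by (auto simp: cond_st_def W_iff Skip_iff)
    qed
  qed
  moreover have "X \<le> W" if X: "X \<in> carrier contract_order" "X \<le> ?F X" for X
  proof -
    obtain X1 X2 X3 where X_eq: "X = contract X1 X2 X3" and wf_X: "wf_contract X1 X2 X3"
      using X(1) by (auto simp: contract_order_def)
    then have "is_CRR X1" "is_CRR X2" "is_CRR X3"
      by (auto simp: wf_contract_def is_CRC_def)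
    note X_iff = contract_iff[OF this, folded X_eq]
    have "X v v' \<Longrightarrow> W v v'" for v v'
    \<comment> \<open>The final observation stays fixed while the initial one moves forward by one
      iteration at a time.\<close>
    proof (induction "length (tr v') - length (tr v)" arbitrary: v rule: less_induct)
      case less
      have pre: "prefix (tr v) (tr v')"
        using less.prems by (simp add: X_iff)
      have FX: "?F X v v'"
        using less.prems X(2) by blast
      show "W v v'"
      proof (cases "ok v \<and> \<not> wait v")
        case False
        then show ?thesis
          using less.prems by (auto simp: W_iff X_iff)
      next
        case True
        show ?thesis
        proof (cases "b (st v)")
          case False
          then show ?thesis
            using FX True W3[of v v'] by (auto simp: cond_st_def Skip_iff W_iff)
        next
          case b: True
          then have "(?P OO X) v v'"
            using FX by (simp add: cond_st_def)
          then consider "\<not> P1 v v'" | "ok v'" "wait v'" "P2 v v'"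
            | m where "ok m" "\<not> wait m" "P3 v m" "X m v'"
            using True by (auto simp: contract_OO_iff[OF assms(1) wf_X, folded X_eq])
          then show ?thesis
          proof cases
            case 1
            then have "rea_not W1 v v'"
              using not_W1[of v v'] b pre by (simp add: rea_not_def[of P1])
            then show ?thesis
              using True by (simp add: W_iff rea_not_def)
          next
            case 2
            then show ?thesis
              using True b pre W2[of v v'] by (simp add: W_iff)
          next
            case 3
            \<comment> \<open>Strict growth of the trace in \<open>P3\<close> makes the measure
              decrease. As subtraction on naturals truncates, \<open>pre_m\<close> is needed
              too.\<close>
            have "tt v m \<noteq> []"
              using assms(2) 3(3) by (metis prefix_order.less_irrefl)
            moreover obtain t where "tr m = tr v @ t"
              using CRR_prefix[OF CRR(3) 3(3)] by (auto simp: prefix_def)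
            moreover have pre_m: "prefix (tr m) (tr v')"
              using 3(4) by (simp add: X_iff)
            ultimately have "length (tr v') - length (tr m) < length (tr v') - length (tr v)"
              by (auto simp: prefix_def tt_def)
            then have "W m v'"
              using less.hyps 3(4) by blast
            \<comment> \<open>Divergence of the remaining loop is divergence of the whole loop, so
              \<open>W m v'\<close> can be transferred to \<open>v\<close> whether or not
              \<open>W1\<close> holds at \<open>m\<close>.\<close>
            moreover have "rea_not W1 v v'" if "rea_not W1 m v'"
              using not_W1[of v v'] b 3(3) that by blast
            ultimately show ?thesis
              using True 3 b pre pre_m W2[of v v'] W3[of v v']
              by (auto simp: W_iff rea_not_def split: if_splits)
          qed
        qed
      qed
    qed
    then show ?thesis
      by (intro predicate2I)
  qed
  ultimately have "LFP\<^bsub>contract_order\<^esub> ?F = W"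
    by (rule LFP_contract_eqI)
  then show ?thesis
    by (simp add: While_def W_def W1_def W2_def W3_def Q_def)
qed

end
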